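(* If $\alpha$ is an odd norm-perfect Gaussian integer, then $\alpha=\pi^k\gamma^2$ for some Gaussian prime $\pi$, some Gaussian integer $\gamma$ with $\gcd(\pi,\gamma)=1$, and some odd rational integer $k$.
   Context: $\mathbb{Z}[i]$ denotes the Gaussian integers, with norm $N(a+bi)=a^2+b^2$. A Gaussian integer is called even if it is divisible by $1+i$, and odd otherwise. The sum-of-divisors function (Spira) is defined as follows: write a nonzero Gaussian integer as $\eta=\varepsilon\prod_i \pi_i^{k_i}$ with $\varepsilon\in\{\pm1,\pm i\}$ a unit and each $\pi_i$ a Gaussian prime in the first quadrant ($\mathrm{Re}(\pi_i)>0$, $\mathrm{Im}(\pi_i)\ge 0$), pairwise non-associate; then $\sigma(\eta)=\prod_i \frac{\pi_i^{k_i+1}-1}{\pi_i-1}$. A Gaussian integer $\eta$ is norm-perfect if $N(\sigma(\eta))=N(1+i)N(\eta)=2N(\eta)$. *)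

theory Defs
  imports "HOL-Computational_Algebra.Computational_Algebra"
begin

section \<open>The ring of Gaussian integers\<close>

datatype gauss_int = Gauss (ReG: int) (ImG: int)

lemma gauss_eq_iff: "x = y \<longleftrightarrow> ReG x = ReG y \<and> ImG x = ImG y"
  by (cases x; cases y) simp

instantiation gauss_int :: comm_ring_1
begin

definition zero_gauss_int :: gauss_int where
  "0 = Gauss 0 0"

definition one_gauss_int :: gauss_int where
  "1 = Gauss 1 0"

definition plus_gauss_int :: "gauss_int \<Rightarrow> gauss_int \<Rightarrow> gauss_int" where
  "x + y = Gauss (ReG x + ReG y) (ImG x + ImG y)"

definition uminus_gauss_int :: "gauss_int \<Rightarrow> gauss_int" where
  "- x = Gauss (- ReG x) (- ImG x)"

definition minus_gauss_int :: "gauss_int \<Rightarrow> gauss_int \<Rightarrow> gauss_int" where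
  "x - y = Gauss (ReG x - ReG y) (ImG x - ImG y)"

definition times_gauss_int :: "gauss_int \<Rightarrow> gauss_int \<Rightarrow> gauss_int" where
  "x * y = Gauss (ReG x * ReG y - ImG x * ImG y) (ReG x * ImG y + ImG x * ReG y)"

instance
  by standard
    (simp_all add: gauss_eq_iff zero_gauss_int_def one_gauss_int_def plus_gauss_int_def
      uminus_gauss_int_def minus_gauss_int_def times_gauss_int_def algebra_simps)

end

lemma gauss_sel_simps [simp]:
  "ReG 0 = 0" "ImG 0 = 0" "ReG 1 = 1" "ImG 1 = 0"
  "ReG (x + y) = ReG x + ReG y" "ImG (x + y) = ImG x + ImG y"
  "ReG (x - y) = ReG x - ReG y" "ImG (x - y) = ImG x - ImG y"
  "ReG (- x) = - ReG x" "ImG (- x) = - ImG x"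
  "ReG (x * y) = ReG x * ReG y - ImG x * ImG y"
  "ImG (x * y) = ReG x * ImG y + ImG x * ReG y"
  by (simp_all add: zero_gauss_int_def one_gauss_int_def plus_gauss_int_def
      uminus_gauss_int_def minus_gauss_int_def times_gauss_int_def)

definition gauss_i :: gauss_int where
  "gauss_i = Gauss 0 1"

lemma gauss_i_sel [simp]: "ReG gauss_i = 0" "ImG gauss_i = 1"
  by (simp_all add: gauss_i_def)

definition gauss_cnj :: "gauss_int \<Rightarrow> gauss_int" where
  "gauss_cnj x = Gauss (ReG x) (- ImG x)"

lemma gauss_cnj_sel [simp]: "ReG (gauss_cnj x) = ReG x" "ImG (gauss_cnj x) = - ImG x"
  by (simp_all add: gauss_cnj_def)

definition gauss_norm :: "gauss_int \<Rightarrow> int" where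
  "gauss_norm x = (ReG x)\<^sup>2 + (ImG x)\<^sup>2"

lemma gauss_norm_nonneg [simp]: "gauss_norm x \<ge> 0"
  by (simp add: gauss_norm_def)

lemma gauss_norm_eq_0_iff [simp]: "gauss_norm x = 0 \<longleftrightarrow> x = 0"
  by (simp add: gauss_norm_def gauss_eq_iff sum_power2_eq_zero_iff)

lemma gauss_norm_pos_iff [simp]: "gauss_norm x > 0 \<longleftrightarrow> x \<noteq> 0"
  using gauss_norm_nonneg[of x] gauss_norm_eq_0_iff[of x] by linarith

lemma gauss_norm_mult: "gauss_norm (x * y) = gauss_norm x * gauss_norm y"
  by (simp add: gauss_norm_def power2_eq_square algebra_simps)

instance gauss_int :: idom
proof
  fix x y :: gauss_int
  assume "x \<noteq> 0" "y \<noteq> 0"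
  hence "gauss_norm (x * y) \<noteq> 0"
    by (simp add: gauss_norm_mult)
  thus "x * y \<noteq> 0"
    by auto
qed


section \<open>Division with remainder and factorization\<close>

text \<open>
  The quotient is \<open>x / y\<close> with both coordinates rounded to a nearest integer; it is the exact
  quotient whenever \<open>y\<close> divides \<open>x\<close>. The canonical associate of a nonzero Gaussian integer is
  the one with positive real part and nonnegative imaginary part, so that the library's
  \<^const>\<open>prime\<close> denotes the Gaussian primes in the first quadrant, whereas
  \<^const>\<open>prime_elem\<close> denotes arbitrary Gaussian primes.
\<close>

definition round_quot :: "int \<Rightarrow> int \<Rightarrow> int" where
  "round_quot a n = (2 * a + n) div (2 * n)"

lemma round_quot_mult:
  assumes "n > 0"
  shows "round_quot (a * n) n = a"
proof -
  have "round_quot (a * n) n = (n + a * (2 * n)) div (2 * n)"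
    by (simp add: round_quot_def algebra_simps)
  also have "\<dots> = a + n div (2 * n)"
    using assms by (intro div_mult_self1) simp
  also have "n div (2 * n) = 0"
    using assms by (intro div_pos_pos_trivial) simp_all
  finally show ?thesis by simp
qed

lemma round_quot_bound:
  assumes "n > 0"
  shows "4 * (a - n * round_quot a n)\<^sup>2 \<le> n\<^sup>2"
proof -
  let ?q = "round_quot a n"
  have "2 * a + n = 2 * n * ?q + (2 * a + n) mod (2 * n)"
    by (simp add: round_quot_def)
  hence "2 * (a - n * ?q) + n = (2 * a + n) mod (2 * n)"
    by (simp add: algebra_simps)
  moreover have "0 \<le> (2 * a + n) mod (2 * n)" "(2 * a + n) mod (2 * n) < 2 * n"
    using assms by simp_all
  ultimately have "\<bar>2 * (a - n * ?q)\<bar> \<le> \<bar>n\<bar>"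
    using assms by linarith
  hence "(2 * (a - n * ?q))\<^sup>2 \<le> n\<^sup>2"
    by (simp only: abs_le_square_iff)
  moreover have "(2 * (a - n * ?q))\<^sup>2 = 4 * (a - n * ?q)\<^sup>2"
    by (subst power_mult_distrib) simp
  ultimately show ?thesis
    by linarith
qed

lemma gauss_unit_cases:
  fixes u :: gauss_int
  assumes "u dvd 1"
  shows "u = 1 \<or> u = -1 \<or> u = gauss_i \<or> u = - gauss_i"
proof -
  from assms obtain v where "1 = u * v" by (elim dvdE)
  hence "gauss_norm u * gauss_norm v = gauss_norm 1"
    by (simp only: gauss_norm_mult[symmetric])
  hence "gauss_norm u * gauss_norm v = 1"
    by (simp add: gauss_norm_def)
  hence "gauss_norm u = 1"
    using gauss_norm_nonneg[of u] gauss_norm_nonneg[of v] by (smt (verit) zmult_eq_1_iff)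
  hence n: "(ReG u)\<^sup>2 + (ImG u)\<^sup>2 = 1"
    by (simp add: gauss_norm_def)
  hence "(ReG u)\<^sup>2 \<le> 1\<^sup>2" "(ImG u)\<^sup>2 \<le> 1\<^sup>2"
    by (smt (verit) one_power2 zero_le_power2)+
  hence "\<bar>ReG u\<bar> \<le> 1" "\<bar>ImG u\<bar> \<le> 1"
    by (simp_all only: abs_le_square_iff[symmetric])
  hence "ReG u \<in> {-1, 0, 1}" "ImG u \<in> {-1, 0, 1}"
    by auto
  thus ?thesis
    using n by (auto simp: gauss_eq_iff)
qed

instantiation gauss_int :: normalization_euclidean_semiring
begin

definition divide_gauss_int :: "gauss_int \<Rightarrow> gauss_int \<Rightarrow> gauss_int" where
  "x div y = Gauss (round_quot (ReG (x * gauss_cnj y)) (gauss_norm y))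
                   (round_quot (ImG (x * gauss_cnj y)) (gauss_norm y))"

definition modulo_gauss_int :: "gauss_int \<Rightarrow> gauss_int \<Rightarrow> gauss_int" where
  "x mod y = x - x div y * (y :: gauss_int)"

definition euclidean_size_gauss_int :: "gauss_int \<Rightarrow> nat" where
  "euclidean_size x = nat (gauss_norm x)"

definition unit_factor_gauss_int :: "gauss_int \<Rightarrow> gauss_int" where
  "unit_factor x =
     (if x = 0 then 0
      else if ReG x > 0 \<and> ImG x \<ge> 0 then 1
      else if ReG x \<le> 0 \<and> ImG x > 0 then gauss_i
      else if ReG x < 0 \<and> ImG x \<le> 0 then - 1
      else - gauss_i)"

definition normalize_gauss_int :: "gauss_int \<Rightarrow> gauss_int" where
  "normalize x = gauss_cnj (unit_factor x) * x"

instance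
proof
  fix a b :: gauss_int
  have norm_eq: "b * gauss_cnj b = Gauss (gauss_norm b) 0"
    by (simp add: gauss_eq_iff gauss_norm_def power2_eq_square)
  show "a div 0 = 0"
    by (simp add: divide_gauss_int_def round_quot_def gauss_norm_def gauss_eq_iff)
  show "a * b div b = a" if "b \<noteq> 0"
  proof -
    have "a * b * gauss_cnj b = a * Gauss (gauss_norm b) 0"
      by (simp add: mult.assoc norm_eq)
    thus ?thesis
      using that by (simp add: divide_gauss_int_def gauss_eq_iff round_quot_mult)
  qed
  show "a div b * b + a mod b = a"
    by (simp add: modulo_gauss_int_def)
  show "euclidean_size (0 :: gauss_int) = 0"
    by (simp add: euclidean_size_gauss_int_def gauss_norm_def)
  show "euclidean_size (a mod b) < euclidean_size b" if "b \<noteq> 0"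
  proof -
    let ?n = "gauss_norm b"
    let ?z = "a * gauss_cnj b"
    have n: "?n > 0" using that by simp
    have "(a mod b) * gauss_cnj b = ?z - a div b * (b * gauss_cnj b)"
      by (simp add: modulo_gauss_int_def algebra_simps)
    hence eq: "(a mod b) * gauss_cnj b =
        Gauss (ReG ?z - ?n * round_quot (ReG ?z) ?n) (ImG ?z - ?n * round_quot (ImG ?z) ?n)"
      by (simp add: norm_eq divide_gauss_int_def gauss_eq_iff mult.commute)
    have "gauss_norm (a mod b) * ?n = gauss_norm ((a mod b) * gauss_cnj b)"
      by (simp add: gauss_norm_mult) (simp add: gauss_norm_def)
    also have "4 * \<dots> \<le> ?n\<^sup>2 + ?n\<^sup>2"
      using round_quot_bound[OF n, of "ReG ?z"] round_quot_bound[OF n, of "ImG ?z"]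
      unfolding eq by (simp add: gauss_norm_def)
    finally have "4 * gauss_norm (a mod b) * ?n \<le> 2 * ?n * ?n"
      by (simp add: power2_eq_square)
    hence "4 * gauss_norm (a mod b) \<le> 2 * ?n"
      using n by (simp only: mult_le_cancel_right)
    hence "gauss_norm (a mod b) < ?n"
      using n by linarith
    thus ?thesis
      using n by (simp add: euclidean_size_gauss_int_def)
  qed
  show "euclidean_size a \<le> euclidean_size (a * b)" if "b \<noteq> 0"
  proof -
    have "gauss_norm a * 1 \<le> gauss_norm a * gauss_norm b"
      using that gauss_norm_pos_iff[of b] by (intro mult_left_mono) (simp_all add: int_one_le_iff_zero_less)
    thus ?thesis
      by (simp add: euclidean_size_gauss_int_def gauss_norm_mult nat_mono)
  qed
  show "unit_factor (0 :: gauss_int) = 0"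
    by (simp add: unit_factor_gauss_int_def)
  show "unit_factor a = a" if "a dvd 1"
    using gauss_unit_cases[OF that] by (auto simp: unit_factor_gauss_int_def gauss_eq_iff)
  have i_dvd: "gauss_i dvd 1" "- gauss_i dvd 1"
  proof -
    have "1 = gauss_i * (- gauss_i)" by (simp add: gauss_eq_iff)
    thus "gauss_i dvd 1" by (rule dvdI)
    thus "- gauss_i dvd 1" by simp
  qed
  show "unit_factor a dvd 1" if "a \<noteq> 0"
    using that i_dvd by (simp add: unit_factor_gauss_int_def)
  show "unit_factor (a * b) = a * unit_factor b" if "a dvd 1"
  proof -
    consider "b = 0" | "ReG b > 0" "ImG b \<ge> 0" | "ReG b \<le> 0" "ImG b > 0"
      | "ReG b < 0" "ImG b \<le> 0" | "ReG b \<ge> 0" "ImG b < 0"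
      unfolding gauss_eq_iff gauss_sel_simps by linarith
    thus ?thesis
      using gauss_unit_cases[OF that]
      by cases (elim disjE; simp add: unit_factor_gauss_int_def gauss_eq_iff)+
  qed
  show "normalize (0 :: gauss_int) = 0"
    by (simp add: normalize_gauss_int_def)
  show "unit_factor a * normalize a = a"
    by (simp add: normalize_gauss_int_def unit_factor_gauss_int_def gauss_eq_iff)
qed

end

instantiation gauss_int :: euclidean_ring_gcd
begin

definition gcd_gauss_int :: "gauss_int \<Rightarrow> gauss_int \<Rightarrow> gauss_int" where
  "gcd_gauss_int = Euclidean_Algorithm.gcd"

definition lcm_gauss_int :: "gauss_int \<Rightarrow> gauss_int \<Rightarrow> gauss_int" where
  "lcm_gauss_int = Euclidean_Algorithm.lcm"

definition Gcd_gauss_int :: "gauss_int set \<Rightarrow> gauss_int" where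
  "Gcd_gauss_int = Euclidean_Algorithm.Gcd"

definition Lcm_gauss_int :: "gauss_int set \<Rightarrow> gauss_int" where
  "Lcm_gauss_int = Euclidean_Algorithm.Lcm"

instance
  by standard
    (simp_all add: gcd_gauss_int_def lcm_gauss_int_def Gcd_gauss_int_def Lcm_gauss_int_def)

end

lemma normalize_gauss_eq_self_iff:
  "x \<noteq> 0 \<Longrightarrow> normalize x = x \<longleftrightarrow> ReG x > 0 \<and> ImG x \<ge> 0"
  by (auto simp: normalize_gauss_int_def unit_factor_gauss_int_def gauss_eq_iff split: if_splits)

lemma prime_gauss_iff: "prime p \<longleftrightarrow> prime_elem p \<and> ReG p > 0 \<and> ImG p \<ge> 0"
proof (cases "p = 0")
  case False
  thus ?thesis
    using normalize_gauss_eq_self_iff[of p] by (auto simp: prime_def)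
qed auto


section \<open>Odd and norm-perfect Gaussian integers\<close>

definition gauss_even :: "gauss_int \<Rightarrow> bool" where
  "gauss_even \<eta> \<longleftrightarrow> 1 + gauss_i dvd \<eta>"

definition gauss_odd :: "gauss_int \<Rightarrow> bool" where
  "gauss_odd \<eta> \<longleftrightarrow> \<not> gauss_even \<eta>"

text \<open>
  Spira's sum-of-divisors function, meaningful for \<open>\<eta> \<noteq> 0\<close>. By \<open>prime_gauss_iff\<close> the product
  ranges over the first-quadrant primes dividing \<open>\<eta>\<close>; the divisions are exact.
\<close>

definition gauss_sigma :: "gauss_int \<Rightarrow> gauss_int" where
  "gauss_sigma \<eta> =
     (\<Prod>p\<in>prime_factors \<eta>. (p ^ (multiplicity p \<eta> + 1) - 1) div (p - 1))"

lemma gauss_sigma_dvd: "(p - 1) dvd (p ^ (k + 1) - (1 :: gauss_int))"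
  by (metis power_diff_1_eq dvd_triv_left)

lemma gauss_sigma_factorization:
  fixes \<epsilon> :: gauss_int and P :: "gauss_int set" and k :: "gauss_int \<Rightarrow> nat"
  assumes "is_unit \<epsilon>" "finite P" "\<And>p. p \<in> P \<Longrightarrow> prime_elem p \<and> ReG p > 0 \<and> ImG p \<ge> 0"
  shows "gauss_sigma (\<epsilon> * (\<Prod>p\<in>P. p ^ k p)) = (\<Prod>p\<in>P. (p ^ (k p + 1) - 1) div (p - 1))"
proof -
  let ?x = "\<epsilon> * (\<Prod>p\<in>P. p ^ k p)"
  have P: "prime p" if "p \<in> P" for p
    using assms(3)[OF that] by (simp add: prime_gauss_iff)
  have zero: "0 \<notin> P"
    using P[of 0] not_prime_0 by metis
  have nz: "(\<Prod>p\<in>P. p ^ k p) \<noteq> 0"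
    using assms(2) zero by (auto simp: prod_zero_iff)
  have mult: "multiplicity p ?x = k p" if "p \<in> P" for p
  proof -
    have "multiplicity p ?x = multiplicity p (\<Prod>q\<in>P. q ^ k q)"
      using assms(1) by (rule multiplicity_times_unit_right)
    also have "\<dots> = (\<Sum>q\<in>P. multiplicity p (q ^ k q))"
      using P that assms(2) zero by (intro prime_elem_multiplicity_prod_distrib) auto
    also have "\<dots> = (\<Sum>q\<in>P. if q = p then k p else 0)"
    proof (intro sum.cong refl)
      fix q assume "q \<in> P"
      show "multiplicity p (q ^ k q) = (if q = p then k p else 0)"
      proof (cases "q = p")
        case True
        have "p \<noteq> 0" "\<not> is_unit p"
          using P[OF that] not_prime_0 not_prime_unit by metis+
        with True show ?thesis by (simp add: multiplicity_same_power)
      next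
        case False
        with P[OF that] P[OF \<open>q \<in> P\<close>] show ?thesis
          by (simp add: multiplicity_distinct_prime_power)
      qed
    qed
    also have "\<dots> = k p"
      using that assms(2) by simp
    finally show ?thesis .
  qed
  have sub: "prime_factors ?x \<subseteq> P"
  proof
    fix q assume "q \<in> prime_factors ?x"
    hence q: "prime q" "q dvd ?x"
      by (auto simp: in_prime_factors_iff)
    hence "q dvd (\<Prod>p\<in>P. p ^ k p)"
      using assms(1) by (simp add: dvd_mult_unit_iff' prime_elem_dvd_mult_iff)
    then obtain p where p: "p \<in> P" "q dvd p ^ k p"
      using q(1) assms(2) by (auto simp: prime_dvd_prod_iff)
    hence "q dvd p"
      using q(1) prime_dvd_power by blast
    hence "q = p"
      using q(1) P p(1) primes_dvd_imp_eq by blast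
    with p show "q \<in> P" by simp
  qed
  have "gauss_sigma ?x = (\<Prod>p\<in>P. (p ^ (multiplicity p ?x + 1) - 1) div (p - 1))"
    unfolding gauss_sigma_def
  proof (intro prod.mono_neutral_left assms(2) sub ballI)
    fix p assume p: "p \<in> P - prime_factors ?x"
    hence "\<not> p dvd ?x"
      using P nz assms(1) by (auto simp: in_prime_factors_iff)
    hence "multiplicity p ?x = 0"
      by (rule not_dvd_imp_multiplicity_0)
    moreover have "p - 1 \<noteq> 0"
      using P[of p] p by auto
    ultimately show "(p ^ (multiplicity p ?x + 1) - 1) div (p - 1) = 1"
      by simp
  qed
  also have "\<dots> = (\<Prod>p\<in>P. (p ^ (k p + 1) - 1) div (p - 1))"
    using mult by (intro prod.cong) simp_all
  finally show ?thesis .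
qed

definition norm_perfect :: "gauss_int \<Rightarrow> bool" where
  "norm_perfect \<eta> \<longleftrightarrow>
     \<eta> \<noteq> 0 \<and> gauss_norm (gauss_sigma \<eta>) = gauss_norm (1 + gauss_i) * gauss_norm \<eta>"

end

(*
  Reduction modulo 1 + i maps Z[i] onto the field with two elements, and an odd prime p satisfies
  1 + p + ... + p^m = m + 1 there. Hence the factor of sigma belonging to p is even exactly when
  its exponent m is odd. Since N(sigma(alpha)) = 2 N(alpha) is twice an odd number, exactly one
  factor is even, so alpha is a unit times p^k times a square, with k odd. The unit is
  absorbed by the square up to a factor i, and that factor by replacing p with an associate.
*)
theory Submission
  imports Defs
begin

lemma even_gauss_norm_iff: "even (gauss_norm x) \<longleftrightarrow> even (ReG x + ImG x)"
  by (simp add: gauss_norm_def)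

text \<open>The squares in the norm do not change parity, so parity of the norm is additive as well
  as multiplicative. It thus serves as the reduction modulo 1 + i, with no quotient ring
  needed.\<close>

lemma even_gauss_norm_add:
  "even (gauss_norm (x + y)) \<longleftrightarrow> (even (gauss_norm x) \<longleftrightarrow> even (gauss_norm y))"
  by (auto simp: even_gauss_norm_iff)

lemma gauss_norm_1 [simp]: "gauss_norm 1 = 1"
  by (simp add: gauss_norm_def)

lemma gauss_norm_power: "gauss_norm (x ^ n) = gauss_norm x ^ n"
  by (induction n) (simp_all add: gauss_norm_mult)

lemma gauss_norm_prod: "gauss_norm (\<Prod>x\<in>A. f x) = (\<Prod>x\<in>A. gauss_norm (f x))"
  by (induction A rule: infinite_finite_induct) (simp_all add: gauss_norm_mult)

lemma gauss_odd_imp_odd_norm: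
  assumes "gauss_odd x"
  shows "odd (gauss_norm x)"
proof
  assume "even (gauss_norm x)"
  hence "even (ReG x + ImG x)" "even (ImG x - ReG x)"
    by (simp_all add: even_gauss_norm_iff)
  then obtain a b where "ReG x + ImG x = 2 * a" "ImG x - ReG x = 2 * b"
    by (elim evenE)
  \<comment> \<open>Multiplying x by (1 - i)/2 gives the quotient by 1 + i; its coordinates are the
    half-sum a and the half-difference b.\<close>
  hence "x = (1 + gauss_i) * Gauss a b"
    by (simp add: gauss_eq_iff)
  hence "gauss_even x"
    unfolding gauss_even_def by (rule dvdI)
  with assms show False
    by (simp add: gauss_odd_def)
qed

text \<open>Every power of p has odd norm, so each further summand flips the parity.\<close>

lemma even_gauss_norm_geometric_sum:
  assumes "odd (gauss_norm p)"
  shows "even (gauss_norm (\<Sum>i<n. p ^ i)) \<longleftrightarrow> even n"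
proof (induction n)
  case 0
  show ?case by (simp add: even_gauss_norm_iff)
next
  case (Suc n)
  with assms show ?case
    by (simp add: even_gauss_norm_add gauss_norm_power)
qed

lemma gauss_sigma_factor_eq:
  fixes p :: gauss_int
  assumes "p \<noteq> 1"
  shows "(p ^ n - 1) div (p - 1) = (\<Sum>i<n. p ^ i)"
  using assms by (simp add: power_diff_1_eq)

text \<open>Some factor is even because 2 is prime; two even factors would contribute 2 * 2 to the
  product.\<close>

lemma unique_even_factor:
  fixes f :: "'a \<Rightarrow> int"
  assumes "finite A" "even (\<Prod>x\<in>A. f x)" "\<not> 4 dvd (\<Prod>x\<in>A. f x)"
  shows "\<exists>!x. x \<in> A \<and> even (f x)"
proof -
  have "\<exists>x\<in>A. even (f x)"
    using assms(1,2) by (simp add: prime_dvd_prod_iff)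
  then obtain x where x: "x \<in> A" "even (f x)" ..
  show ?thesis
  proof (rule ex1I)
    show "x \<in> A \<and> even (f x)"
      using x ..
    fix y assume y: "y \<in> A \<and> even (f y)"
    show "y = x"
    proof (rule ccontr)
      assume "y \<noteq> x"
      with x y assms(1) have "(\<Prod>z\<in>A. f z) = f x * (f y * (\<Prod>z\<in>A - {x} - {y}. f z))"
        by (simp add: prod.remove[of A x] prod.remove[of "A - {x}" y])
      moreover have "2 * 2 dvd f x * (f y * (\<Prod>z\<in>A - {x} - {y}. f z))"
        using x y by (intro mult_dvd_mono dvd_mult2) auto
      ultimately show False
        using assms(3) by simp
    qed
  qed
qed

lemma norm_perfect_unique_odd_exponent:
  assumes "gauss_odd \<alpha>" "norm_perfect \<alpha>"
  shows "\<exists>!p. p \<in> prime_factors \<alpha> \<and> odd (multiplicity p \<alpha>)"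
proof -
  let ?f = "\<lambda>p. gauss_norm ((p ^ (multiplicity p \<alpha> + 1) - 1) div (p - 1))"
  have odd: "odd (gauss_norm \<alpha>)"
    using assms(1) by (rule gauss_odd_imp_odd_norm)
  have "gauss_norm (1 + gauss_i) = 2"
    by (simp add: gauss_norm_def)
  with assms(2) have eq: "(\<Prod>p\<in>prime_factors \<alpha>. ?f p) = 2 * gauss_norm \<alpha>"
    by (simp add: norm_perfect_def gauss_sigma_def gauss_norm_prod)
  have "\<not> 4 dvd 2 * gauss_norm \<alpha>"
    using odd by presburger
  hence "\<exists>!p. p \<in> prime_factors \<alpha> \<and> even (?f p)"
    by (intro unique_even_factor) (simp_all only: eq finite_set_mset dvd_triv_left not_False_eq_True)
  moreover have "even (?f p) \<longleftrightarrow> odd (multiplicity p \<alpha>)" if "p \<in> prime_factors \<alpha>" for p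
  proof -
    have "p \<noteq> 1"
      using that not_prime_1 by (metis in_prime_factors_imp_prime)
    have "p dvd \<alpha>"
      using that by (rule in_prime_factors_imp_dvd)
    then obtain c where "\<alpha> = p * c" ..
    with odd have "odd (gauss_norm p)"
      by (simp add: gauss_norm_mult)
    \<comment> \<open>The geometric sum has one term more than the exponent of p, which turns even
      into odd.\<close>
    thus ?thesis
      by (simp only: gauss_sigma_factor_eq[OF \<open>p \<noteq> 1\<close>] even_gauss_norm_geometric_sum
        even_add odd_one simp_thms)
  qed
  ultimately show ?thesis
    by (simp cong: conj_cong)
qed

text \<open>The unit is unavoidable, since products of normalized primes need not be normalized: (2
  + i)(1 + 2i) = 5i.\<close>

lemma prod_prime_factors_associated:
  fixes a :: "'a :: factorial_semiring"
  assumes "a \<noteq> 0"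
  obtains e where "is_unit e" "a = e * (\<Prod>p\<in>prime_factors a. p ^ multiplicity p a)"
proof -
  have "(\<Prod>p\<in>prime_factors a. p ^ multiplicity p a) = prod_mset (prime_factorization a)"
    unfolding prod_mset_multiplicity using assms
    by (intro prod.cong)
      (simp_all add: count_prime_factorization_prime in_prime_factors_imp_prime)
  with assms have "normalize a = normalize (\<Prod>p\<in>prime_factors a. p ^ multiplicity p a)"
    by (simp add: prod_mset_prime_factorization_weak)
  thus ?thesis
    by (elim associatedE1) (rule that)
qed

lemma unique_odd_exponent_decomp:
  fixes a :: "'a :: {factorial_semiring, semiring_gcd}"
  assumes "a \<noteq> 0" "\<exists>!p. p \<in> prime_factors a \<and> odd (multiplicity p a)"
  obtains p c e k where "prime p" "coprime p c" "is_unit e" "odd k" "a = e * (p ^ k * c ^ 2)"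
proof -
  obtain p where p: "p \<in> prime_factors a" "odd (multiplicity p a)"
    and uniq: "\<And>q. q \<in> prime_factors a \<Longrightarrow> odd (multiplicity q a) \<Longrightarrow> q = p"
    using assms(2) by blast
  \<comment> \<open>Only the primes other than p enter c, which makes it coprime to p; the whole
    power of p stays outside the square. The remaining exponents are even, so halving them is
    exact.\<close>
  define c where "c = (\<Prod>q\<in>prime_factors a - {p}. q ^ (multiplicity q a div 2))"
  have "prime p"
    using p by auto
  have "coprime p c"
    unfolding c_def
  proof (intro prod_coprime_right)
    fix q assume "q \<in> prime_factors a - {p}"
    hence "coprime p q"
      using \<open>prime p\<close> by (intro primes_coprime) auto
    thus "coprime p (q ^ (multiplicity q a div 2))"
      by simp
  qed
  have "c ^ 2 = (\<Prod>q\<in>prime_factors a - {p}. q ^ multiplicity q a)"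
    unfolding c_def prod_power_distrib
  proof (intro prod.cong refl)
    fix q assume "q \<in> prime_factors a - {p}"
    hence "even (multiplicity q a)"
      using uniq by blast
    thus "(q ^ (multiplicity q a div 2)) ^ 2 = q ^ multiplicity q a"
      by (simp flip: power_mult)
  qed
  hence "p ^ multiplicity p a * c ^ 2 = (\<Prod>q\<in>prime_factors a. q ^ multiplicity q a)"
    using p(1) by (simp add: prod.remove[of "prime_factors a" p])
  moreover obtain e where "is_unit e" "a = e * (\<Prod>q\<in>prime_factors a. q ^ multiplicity q a)"
    using assms(1) by (rule prod_prime_factors_associated)
  ultimately show ?thesis
    using that \<open>prime p\<close> \<open>coprime p c\<close> p(2) by metis
qed

text \<open>The signs are squares because -1 is the square of i. For odd k the power
  \<open>gauss_i ^ k\<close> is i up to sign, so u = i accounts for the other two units.\<close>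

lemma gauss_unit_eq_odd_power_times_square:
  fixes e :: gauss_int
  assumes "is_unit e" "odd k"
  shows "\<exists>u v. is_unit u \<and> is_unit v \<and> e = u ^ k * v ^ 2"
proof -
  have i2: "gauss_i ^ 2 = -1"
    by (simp add: power2_eq_square gauss_eq_iff)
  have unit_i: "is_unit gauss_i"
    by (rule dvdI[of _ _ "- gauss_i"]) (simp add: gauss_eq_iff)
  have square: "\<exists>v. is_unit v \<and> s = v ^ 2" if "s = 1 \<or> s = -1" for s :: gauss_int
    using that
  proof
    assume "s = 1"
    thus ?thesis by (intro exI[of _ 1]) simp
  next
    assume "s = -1"
    thus ?thesis using i2 unit_i by (intro exI[of _ gauss_i]) simp
  qed
  obtain m where m: "k = 2 * m + 1"
    using assms(2) by (elim oddE)
  have ik: "gauss_i ^ k = gauss_i * (-1) ^ m"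
    by (simp add: m power_mult i2)
  have sign: "(-1 :: gauss_int) ^ m = 1 \<or> (-1 :: gauss_int) ^ m = -1"
    by (cases "even m") simp_all
  obtain u s where "is_unit u" "s = 1 \<or> s = -1" "e = u ^ k * s"
  proof (cases "e = 1 \<or> e = -1")
    case True
    thus ?thesis
      by (intro that[of 1 e]) simp_all
  next
    case False
    hence "e = gauss_i \<or> e = - gauss_i"
      using gauss_unit_cases[OF assms(1)] by blast
    hence "\<exists>s. (s = 1 \<or> s = -1) \<and> e = gauss_i ^ k * s"
      using sign by (auto simp: ik)
    then obtain s where "s = 1 \<or> s = -1" "e = gauss_i ^ k * s"
      by (elim exE conjE)
    with unit_i show ?thesis
      by (rule that)
  qed
  moreover from this obtain v where "is_unit v" "s = v ^ 2"
    using square by blast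
  ultimately show ?thesis
    by (intro exI[of _ u] exI[of _ v]) simp
qed

theorem mainTheorem2:
  fixes \<alpha> :: gauss_int
  assumes "gauss_odd \<alpha>" and "norm_perfect \<alpha>"
  shows "\<exists>p \<gamma> :: gauss_int. \<exists>k :: nat.
    prime_elem p \<and> gcd p \<gamma> = 1 \<and> odd k \<and> \<alpha> = p ^ k * \<gamma> ^ 2"
proof -
  have nz: "\<alpha> \<noteq> 0"
    using assms(2) by (simp add: norm_perfect_def)
  obtain p c e k where p: "prime p" "coprime p c" "odd k"
    and e: "is_unit e" and \<alpha>: "\<alpha> = e * (p ^ k * c ^ 2)"
    using nz norm_perfect_unique_odd_exponent[OF assms] by (rule unique_odd_exponent_decomp)
  obtain u v where uv: "is_unit u" "is_unit v" "e = u ^ k * v ^ 2"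
    using gauss_unit_eq_odd_power_times_square[OF e p(3)] by blast
  \<comment> \<open>The associate u * p may leave the first quadrant, so it is a
    \<open>prime_elem\<close> but not always a \<open>prime\<close>.\<close>
  have "prime_elem (u * p)"
    using p(1) uv(1) by (simp add: prime_elem_mult_unit_left)
  moreover have "gcd (u * p) (v * c) = 1"
    using p(2) uv(1,2)
    by (simp add: coprime_iff_gcd_eq_1[symmetric] is_unit_left_imp_coprime is_unit_right_imp_coprime)
  moreover have "\<alpha> = (u * p) ^ k * (v * c) ^ 2"
    using \<alpha> unfolding uv(3) by (simp add: power_mult_distrib mult_ac)
  ultimately show ?thesis
    using p(3) by (intro exI[of _ "u * p"] exI[of _ "v * c"] exI[of _ k]) simp
qed

end
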